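(* Let $k\geq 1$ and $t\geq 1$. As elements of $W_1=\mathbb{F}_2[w_1,\ldots,w_k]$, $$\sum_{i\geq 0\text{ even}}w_i\,p_{2^t-i}=w_1^{2^t-1}.$$
   Context: $W_1=\mathbb{F}_2[w_1,\ldots,w_k]$ with $\deg w_i=i$; conventions $w_0=1$ and $w_i=0$ for $i>k$. $Q_i\in W_1$ is the degree $i$ part of $(1+w_1+\cdots+w_k)^{-1}$ (zero for $i<0$), $\tilde q_i=Q_i|_{w_1=0}\in W_1$, and $p_i\in W_1$ is the unique element with $w_1p_i=Q_i+\tilde q_i$. *)

theory Defs
  imports
    "HOL-Library.Poly_Mapping"
    "HOL-Library.Z2"
    "HOL-Computational_Algebra.Formal_Power_Series"
begin

text \<open>
  A monomial is its exponent function \<open>nat \<Rightarrow>\<^sub>0 nat\<close>. The type below is the polynomial ring over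
  \<open>\<F>\<^sub>2\<close> (the type \<^typ>\<open>bit\<close>) in variables \<open>w\<^sub>j\<close>, one for each natural number \<open>j\<close>; the ring
  \<open>W\<^sub>1 = \<F>\<^sub>2[w\<^sub>1, \<dots>, w\<^sub>k]\<close> is the subring \<open>W1 k\<close> of those polynomials that involve only
  \<open>w\<^sub>1, \<dots>, w\<^sub>k\<close>.
\<close>

type_synonym f2poly = "(nat \<Rightarrow>\<^sub>0 nat) \<Rightarrow>\<^sub>0 bit"

definition W1 :: "nat \<Rightarrow> f2poly set" where
  "W1 k = {f. \<forall>m\<in>Poly_Mapping.keys f. Poly_Mapping.keys m \<subseteq> {1..k}}"

definition var :: "nat \<Rightarrow> f2poly" where
  "var j = Poly_Mapping.single (Poly_Mapping.single j 1) 1"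

definition w :: "nat \<Rightarrow> nat \<Rightarrow> f2poly" where
  "w k i = (if i = 0 then 1 else if i \<le> k then var i else 0)"

text \<open>
  The inverse of \<open>1 + w\<^sub>1 + \<dots> + w\<^sub>k\<close> lives in the completion of the graded ring \<open>W\<^sub>1\<close>
  (where \<open>w\<^sub>i\<close> has degree \<open>i\<close>), the product of its homogeneous parts. An element of the completion
  is written as the power series in an auxiliary variable whose \<open>n\<close>-th coefficient is the
  degree \<open>n\<close> part of the element; the product of the completion is then the product of power series.
  The second argument 1 of \<open>fps_right_inverse\<close> is the inverse of the constant coefficient.
\<close>

definition total_w :: "nat \<Rightarrow> f2poly fps" where
  "total_w k = Abs_fps (w k)"

definition Q :: "nat \<Rightarrow> int \<Rightarrow> f2poly" where
  "Q k i = (if i < 0 then 0 else fps_nth (fps_right_inverse (total_w k) 1) (nat i))"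

lemma total_w_mult_inverse: "total_w k * fps_right_inverse (total_w k) 1 = 1"
  by (rule fps_right_inverse) (simp add: total_w_def w_def)

definition weighted_degree :: "(nat \<Rightarrow>\<^sub>0 nat) \<Rightarrow> nat" where
  "weighted_degree m = (\<Sum>j\<in>Poly_Mapping.keys m. j * Poly_Mapping.lookup m j)"

definition homogeneous_part :: "nat \<Rightarrow> nat \<Rightarrow> f2poly set" where
  "homogeneous_part k n = {f \<in> W1 k. \<forall>m\<in>Poly_Mapping.keys f. weighted_degree m = n}"

lemma weighted_degree_add: "weighted_degree (a + b) = weighted_degree a + weighted_degree b"
proof -
  let ?S = "Poly_Mapping.keys a \<union> Poly_Mapping.keys b"
  have *: "weighted_degree c = (\<Sum>j\<in>?S. j * Poly_Mapping.lookup c j)"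
    if "Poly_Mapping.keys c \<subseteq> ?S" for c
    unfolding weighted_degree_def
    by (rule sum.mono_neutral_left) (use that in \<open>auto simp: in_keys_iff\<close>)
  show ?thesis
    using *[of "a + b"] *[of a] *[of b] Poly_Mapping.keys_add[of a b]
    by (simp add: lookup_add algebra_simps sum.distrib)
qed

lemma homogeneous_part_mult:
  assumes "f \<in> homogeneous_part k a" "g \<in> homogeneous_part k b"
  shows "f * g \<in> homogeneous_part k (a + b)"
proof -
  have "Poly_Mapping.keys m \<subseteq> {1..k} \<and> weighted_degree m = a + b"
    if "m \<in> Poly_Mapping.keys (f * g)" for m
  proof -
    obtain x y where xy: "m = x + y" "x \<in> Poly_Mapping.keys f" "y \<in> Poly_Mapping.keys g"
      using \<open>m \<in> Poly_Mapping.keys (f * g)\<close> keys_mult[of f g] by blast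
    then have "Poly_Mapping.keys x \<subseteq> {1..k}" "Poly_Mapping.keys y \<subseteq> {1..k}"
      "weighted_degree x = a" "weighted_degree y = b"
      using assms by (simp_all add: homogeneous_part_def W1_def)
    then show ?thesis
      using Poly_Mapping.keys_add[of x y] unfolding xy(1) weighted_degree_add by blast
  qed
  then show ?thesis by (auto simp: homogeneous_part_def W1_def)
qed

lemma homogeneous_part_uminus: "f \<in> homogeneous_part k n \<Longrightarrow> - f \<in> homogeneous_part k n"
  by (simp add: homogeneous_part_def W1_def)

lemma homogeneous_part_sum:
  "(\<And>i. i \<in> I \<Longrightarrow> f i \<in> homogeneous_part k n) \<Longrightarrow> sum f I \<in> homogeneous_part k n"
proof (induction I rule: infinite_finite_induct)
  case (insert i I)
  then have "f i \<in> homogeneous_part k n" "sum f I \<in> homogeneous_part k n"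
    by simp_all
  moreover have "Poly_Mapping.keys (sum f (insert i I))
      \<subseteq> Poly_Mapping.keys (f i) \<union> Poly_Mapping.keys (sum f I)"
    using insert.hyps Poly_Mapping.keys_add[of "f i" "sum f I"] by simp
  ultimately show ?case
    unfolding homogeneous_part_def W1_def by blast
qed (simp_all add: homogeneous_part_def W1_def)

lemma w_homogeneous: "w k i \<in> homogeneous_part k i"
  by (auto simp: w_def var_def homogeneous_part_def W1_def weighted_degree_def)

lemma Q_homogeneous: "Q k (int n) \<in> homogeneous_part k n"
proof (induction n rule: less_induct)
  case (less n)
  show ?case
  proof (cases n)
    case 0
    then show ?thesis
      by (simp add: Q_def homogeneous_part_def W1_def weighted_degree_def)
  next
    case (Suc l)
    have "w k i * fps_right_inverse_constructor (total_w k) 1 (n - i) \<in> homogeneous_part k n"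
      if "i \<in> {1..n}" for i
      using homogeneous_part_mult[OF w_homogeneous[of k i] less.IH[of "n - i"]] that
      by (simp add: Q_def nat_diff_distrib flip: of_nat_diff)
    then have "(\<Sum>i=1..n. w k i * fps_right_inverse_constructor (total_w k) 1 (n - i))
        \<in> homogeneous_part k n"
      by (rule homogeneous_part_sum)
    moreover have "Q k (int n) =
        - (\<Sum>i=1..n. w k i * fps_right_inverse_constructor (total_w k) 1 (n - i))"
      unfolding Suc Q_def
      by (simp add: total_w_def del: of_nat_Suc sum.cl_ivl_Suc)
    ultimately show ?thesis
      by (simp add: homogeneous_part_uminus)
  qed
qed

definition substitute :: "(nat \<Rightarrow> f2poly) \<Rightarrow> f2poly \<Rightarrow> f2poly" where
  "substitute s f = (\<Sum>m\<in>Poly_Mapping.keys f.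
     Poly_Mapping.single 0 (Poly_Mapping.lookup f m) *
     (\<Prod>j\<in>Poly_Mapping.keys m. s j ^ Poly_Mapping.lookup m j))"

definition q_tilde :: "nat \<Rightarrow> int \<Rightarrow> f2poly" where
  "q_tilde k i = substitute (var(1 := 0)) (Q k i)"

lemma prod_var: "(\<Prod>j\<in>A. var j ^ e j) = Poly_Mapping.single (\<Sum>j\<in>A. Poly_Mapping.single j (e j)) 1"
proof -
  have "var j ^ n = Poly_Mapping.single (Poly_Mapping.single j n) 1" for j n
    by (induction n) (simp_all add: var_def mult_single flip: single_add)
  then show ?thesis
    by (induction A rule: infinite_finite_induct) (simp_all add: mult_single)
qed

lemma sum_single_lookup:
  "(\<Sum>j\<in>Poly_Mapping.keys f. Poly_Mapping.single j (Poly_Mapping.lookup f j)) = f"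
proof (rule poly_mapping_eqI)
  fix i
  show "Poly_Mapping.lookup (\<Sum>j\<in>Poly_Mapping.keys f. Poly_Mapping.single j (Poly_Mapping.lookup f j)) i
      = Poly_Mapping.lookup f i"
    by (simp add: lookup_sum lookup_single when_def in_keys_iff)
qed

lemma substitute_var_0:
  "substitute (var(1 := 0)) f =
     (\<Sum>m\<in>{m\<in>Poly_Mapping.keys f. Poly_Mapping.lookup m 1 = 0}.
        Poly_Mapping.single m (Poly_Mapping.lookup f m))"
proof -
  have "Poly_Mapping.single 0 c * (\<Prod>j\<in>Poly_Mapping.keys m. (var(1 := 0)) j ^ Poly_Mapping.lookup m j)
      = (if Poly_Mapping.lookup m 1 = 0 then Poly_Mapping.single m c else 0)" for m c
  proof (cases "Poly_Mapping.lookup m 1 = 0")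
    case True
    then have "(\<Prod>j\<in>Poly_Mapping.keys m. (var(1 := 0)) j ^ Poly_Mapping.lookup m j)
        = (\<Prod>j\<in>Poly_Mapping.keys m. var j ^ Poly_Mapping.lookup m j)"
      by (intro prod.cong) (auto simp: in_keys_iff)
    also have "\<dots> = Poly_Mapping.single m 1"
      by (simp add: prod_var sum_single_lookup)
    finally show ?thesis
      using True by (simp add: mult_single)
  next
    case False
    then have "(\<Prod>j\<in>Poly_Mapping.keys m. (var(1 := 0)) j ^ Poly_Mapping.lookup m j) = 0"
      by (intro prod_zero) (auto simp: in_keys_iff intro!: bexI[of _ 1])
    then show ?thesis
      using False by simp
  qed
  then show ?thesis
    by (simp add: substitute_def sum.inter_filter)
qed

definition p :: "nat \<Rightarrow> int \<Rightarrow> f2poly" where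
  "p k i = (THE f. f \<in> W1 k \<and> w k 1 * f = Q k i + q_tilde k i)"

lemma p_ex1:
  assumes "k \<ge> 1"
  shows "\<exists>!f. f \<in> W1 k \<and> w k 1 * f = Q k i + q_tilde k i"
proof (rule ex_ex1I)
  define F where "F = Q k i"
  have F: "F \<in> W1 k"
    using Q_homogeneous[of k "nat i"]
    by (cases "i < 0") (auto simp: F_def Q_def W1_def homogeneous_part_def)
  let ?A = "{m\<in>Poly_Mapping.keys F. Poly_Mapping.lookup m 1 = 0}"
  let ?B = "{m\<in>Poly_Mapping.keys F. Poly_Mapping.lookup m 1 \<noteq> 0}"
  let ?e = "Poly_Mapping.single 1 1 :: nat \<Rightarrow>\<^sub>0 nat"
  let ?s = "\<lambda>m. Poly_Mapping.single m (Poly_Mapping.lookup F m)"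
  define g where "g = (\<Sum>m\<in>?B. Poly_Mapping.single (m - ?e) (Poly_Mapping.lookup F m))"
  have "F = sum ?s (?A \<union> ?B)"
    by (subst sum_single_lookup[of F, symmetric]) (rule sum.cong, auto)
  also have "\<dots> = sum ?s ?A + sum ?s ?B"
    by (rule sum.union_disjoint) auto
  finally have "F = sum ?s ?A + sum ?s ?B" .
  then have "F + q_tilde k i = (sum ?s ?A + sum ?s ?A) + sum ?s ?B"
    unfolding q_tilde_def F_def[symmetric] substitute_var_0 by (simp add: ac_simps)
  also have "sum ?s ?A + sum ?s ?A = 0"
    by (rule poly_mapping_eqI, unfold lookup_add) simp
  finally have "F + q_tilde k i = sum ?s ?B"
    by simp
  also have "\<dots> = w k 1 * g"
  proof -
    have "?e + (m - ?e) = m" if "m \<in> ?B" for m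
      using that by (intro poly_mapping_eqI) (auto simp: lookup_add lookup_minus lookup_single when_def)
    then have "var 1 * Poly_Mapping.single (m - ?e) c = Poly_Mapping.single m c" if "m \<in> ?B" for m c
      using that unfolding var_def mult_single by (simp only: mult_1_left)
    then show ?thesis
      using assms unfolding g_def sum_distrib_left by (intro sum.cong) (simp_all add: w_def)
  qed
  finally have eq: "w k 1 * g = F + q_tilde k i"
    by simp
  have "Poly_Mapping.keys m \<subseteq> {1..k}" if "m \<in> Poly_Mapping.keys g" for m
  proof -
    from that obtain n where n: "n \<in> ?B" "m = n - ?e"
      using keys_sum[of "\<lambda>m. Poly_Mapping.single (m - ?e) (Poly_Mapping.lookup F m)" ?B]
      by (fastforce simp: g_def split: if_splits)
    then have "Poly_Mapping.keys m \<subseteq> Poly_Mapping.keys n"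
      by (auto simp: in_keys_iff lookup_minus)
    then show ?thesis
      using n F by (auto simp: W1_def)
  qed
  then show "\<exists>f. f \<in> W1 k \<and> w k 1 * f = Q k i + q_tilde k i"
    using eq by (auto simp: W1_def F_def)
next
  fix f g
  assume "f \<in> W1 k \<and> w k 1 * f = Q k i + q_tilde k i" "g \<in> W1 k \<and> w k 1 * g = Q k i + q_tilde k i"
  then have "w k 1 * f = w k 1 * g"
    by simp
  moreover have "w k 1 \<noteq> 0"
    using assms unfolding w_def var_def by (metis lookup_single_eq lookup_zero one_neq_zero)
  ultimately show "f = g"
    by simp
qed

end

theory Submission
  imports Defs
begin

text \<open>
  For a power series \<open>f\<close> with constant coefficient 1 over a ring of characteristic 2, let \<open>E\<close> be its
  even part. Since \<open>f\<^sup>2\<close> is an even series, so is \<open>f\<^sup>-\<^sup>2\<close>, and the even part of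
  \<open>E / f = E f / f\<^sup>2\<close> is \<open>E\<^sup>2 / f\<^sup>2\<close>. Hence the coefficient of \<open>x\<^bsup>2n\<^esup>\<close> in \<open>E / f\<close> is the
  square of the coefficient of \<open>x\<^sup>n\<close>, and the coefficient at \<open>2\<^sup>t\<close> is the \<open>2\<^sup>t\<close>-th power
  of the coefficient at 1, which is the coefficient \<open>f\<^sub>1\<close>. Apply this to
  \<open>1 + w\<^sub>1 x + w\<^sub>2 x\<^sup>2 + \<dots>\<close> and to the same series with \<open>w\<^sub>1 = 0\<close>, which has the same even part,
  add the results, and cancel \<open>w\<^sub>1\<close>.
\<close>

definition fps_even_part :: "'a::zero fps \<Rightarrow> 'a fps" where
  "fps_even_part f = Abs_fps (\<lambda>n. if even n then fps_nth f n else 0)"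

lemma fps_nth_even_part: "fps_nth (fps_even_part f) n = (if even n then fps_nth f n else 0)"
  by (simp add: fps_even_part_def)

text \<open>The involution i -> n - i pairs equal terms of the convolution, which cancel in
  characteristic 2. Only a fixed point i = n/2 survives.\<close>

lemma fps_nth_square_char_2:
  fixes h :: "'a::comm_ring_1 fps"
  assumes "\<And>x::'a. x + x = 0"
  shows "fps_nth (h * h) n = (if even n then fps_nth h (n div 2) ^ 2 else 0)"
proof -
  let ?g = "\<lambda>i. fps_nth h i * fps_nth h (n - i)"
  let ?L = "{i. 2 * i < n}" and ?R = "{i. i \<le> n \<and> n < 2 * i}" and ?M = "{i. 2 * i = n}"
  have fin: "finite ?L" "finite ?R" "finite ?M"
    by (auto intro: finite_subset[of _ "{..n}"])
  have "fps_nth (h * h) n = sum ?g (?L \<union> ?R \<union> ?M)"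
    unfolding fps_mult_nth by (rule sum.cong) auto
  also have "\<dots> = sum ?g ?L + sum ?g ?R + sum ?g ?M"
    using fin by (subst sum.union_disjoint; (subst sum.union_disjoint)?) auto
  also have "sum ?g ?R = sum ?g ?L"
    by (rule sum.reindex_bij_witness[of _ "\<lambda>i. n - i" "\<lambda>i. n - i"]) (auto simp: mult.commute)
  also have "sum ?g ?L + sum ?g ?L + sum ?g ?M = sum ?g ?M"
    by (simp add: assms)
  also have "?M = (if even n then {n div 2} else {})"
    by auto
  finally show ?thesis
    by (auto simp: power2_eq_square elim!: evenE)
qed

lemma fps_nth_even_part_mult_inverse_double:
  fixes f g :: "'a::comm_ring_1 fps"
  assumes char_2: "\<And>x::'a. x + x = 0" and inv: "f * g = 1"
  shows "fps_nth (fps_even_part f * g) (2 * n) = fps_nth (fps_even_part f * g) n ^ 2"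
proof -
  let ?E = "fps_even_part f"
  define O' where "O' = f - ?E"
  \<comment> \<open>Inserting \<open>f * g = 1\<close> and splitting \<open>f = ?E + O'\<close>
    leaves a square plus \<open>?E * O' * (g * g)\<close>, an odd series times an even one, so the
    second term has no even coefficients.\<close>
  have "?E * g = ?E * g * (f * g)"
    by (simp add: inv)
  also have "\<dots> = (?E * g) * (?E * g) + ?E * O' * (g * g)"
    by (simp add: O'_def algebra_simps)
  finally have eq: "?E * g = (?E * g) * (?E * g) + ?E * O' * (g * g)" .
  have odd: "fps_nth (?E * O') m = 0" if "even m" for m
    unfolding fps_mult_nth
    by (rule sum.neutral) (use that in \<open>auto simp: O'_def fps_nth_even_part\<close>)
  have "fps_nth (?E * O' * (g * g)) (2 * n) = 0"
    unfolding fps_mult_nth[of "?E * O'"]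
  proof (rule sum.neutral, rule ballI)
    fix i assume "i \<in> {0..2 * n}"
    then show "fps_nth (?E * O') i * fps_nth (g * g) (2 * n - i) = 0"
      by (cases "even i") (auto simp: odd fps_nth_square_char_2[OF char_2])
  qed
  then show ?thesis
    by (subst eq) (simp add: fps_nth_square_char_2[OF char_2])
qed

lemma fps_nth_even_part_mult_inverse_power_2:
  fixes f g :: "'a::comm_ring_1 fps"
  assumes char_2: "\<And>x::'a. x + x = 0" and inv: "f * g = 1" and "fps_nth f 0 = 1"
  shows "fps_nth (fps_even_part f * g) (2 ^ t) = fps_nth f 1 ^ (2 ^ t)"
proof (induction t)
  case 0
  \<comment> \<open>The even part has constant coefficient 1 and no linear term, so the coefficient
    wanted is that of \<open>g\<close> at 1; \<open>f * g = 1\<close> makes it the negative of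
    \<open>fps_nth f 1\<close>, hence equal to it.\<close>
  have "fps_nth (f * g) 0 = 1" "fps_nth (f * g) 1 = 0"
    by (simp_all add: inv)
  then have "fps_nth g 0 = 1" "fps_nth g 1 + fps_nth f 1 = 0"
    using \<open>fps_nth f 0 = 1\<close> by (simp_all add: fps_mult_nth)
  then have "fps_nth g 1 = fps_nth f 1"
    using char_2[of "fps_nth f 1"] by (metis add_right_cancel)
  then show ?case
    using \<open>fps_nth f 0 = 1\<close> by (simp add: fps_mult_nth fps_nth_even_part)
next
  case (Suc t)
  then show ?case
    using fps_nth_even_part_mult_inverse_double[OF char_2 inv, of "2 ^ t"]
    by (simp flip: power_mult add: mult.commute)
qed

lemma f2poly_add_self: "x + x = 0" for x :: f2poly
  by (rule poly_mapping_eqI) (simp only: lookup_add lookup_zero, simp)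

definition set_w1_0 :: "f2poly \<Rightarrow> f2poly" where
  "set_w1_0 = substitute (var(1 := 0))"

text \<open>\<open>substitute\<close> sums over the keys of its argument, which may cancel in a sum
  of polynomials; this coefficientwise form makes additivity immediate.\<close>

lemma lookup_set_w1_0:
  "Poly_Mapping.lookup (set_w1_0 f) m =
     (if Poly_Mapping.lookup m 1 = 0 then Poly_Mapping.lookup f m else 0)"
  unfolding set_w1_0_def substitute_var_0
  by (simp add: lookup_sum lookup_single when_def del: bit_not_zero_iff bit_not_one_iff)
    (auto simp: in_keys_iff)

lemma set_w1_0_add: "set_w1_0 (f + g) = set_w1_0 f + set_w1_0 g"
  by (rule poly_mapping_eqI) (simp only: lookup_add lookup_set_w1_0, simp)

lemma set_w1_0_zero: "set_w1_0 0 = 0"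
  by (rule poly_mapping_eqI) (simp add: lookup_set_w1_0)

lemma set_w1_0_sum: "set_w1_0 (sum f I) = (\<Sum>i\<in>I. set_w1_0 (f i))"
  by (induction I rule: infinite_finite_induct)
    (simp_all add: set_w1_0_zero set_w1_0_add)

lemma set_w1_0_single:
  "set_w1_0 (Poly_Mapping.single m c) =
     (if Poly_Mapping.lookup m 1 = 0 then Poly_Mapping.single m c else 0)"
  by (rule poly_mapping_eqI) (auto simp: lookup_set_w1_0 lookup_single when_def)

text \<open>By additivity it suffices to treat monomials, where the exponent of the first variable
  in a product is 0 iff it is 0 in both factors.\<close>

lemma set_w1_0_mult: "set_w1_0 (f * g) = set_w1_0 f * set_w1_0 g"
proof -
  have single: "set_w1_0 (Poly_Mapping.single a x * Poly_Mapping.single b y)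
      = set_w1_0 (Poly_Mapping.single a x) * set_w1_0 (Poly_Mapping.single b y)" for a b x y
    by (simp add: mult_single set_w1_0_single lookup_add)
  let ?sum = "\<lambda>h. \<Sum>m\<in>Poly_Mapping.keys h. Poly_Mapping.single m (Poly_Mapping.lookup h m)"
  have "set_w1_0 (?sum f * ?sum g) = set_w1_0 (?sum f) * set_w1_0 (?sum g)"
    by (simp only: sum_product set_w1_0_sum single)
  then show ?thesis
    by (simp only: sum_single_lookup)
qed

lemma set_w1_0_one: "set_w1_0 1 = 1"
  using set_w1_0_single[of 0 1] by simp

lemma set_w1_0_w: "set_w1_0 (w k i) = (if i = 1 then 0 else w k i)"
  by (auto simp: w_def set_w1_0_one set_w1_0_zero)
    (simp_all add: var_def set_w1_0_single lookup_single)

lemma var_neq_0: "var j \<noteq> 0"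
  unfolding var_def by (metis lookup_single_eq lookup_zero one_neq_zero)

lemma q_tilde_eq: "q_tilde k i = set_w1_0 (Q k i)"
  by (simp add: q_tilde_def set_w1_0_def)

lemma w1_mult_p:
  assumes "k \<ge> 1"
  shows "w k 1 * p k i = Q k i + q_tilde k i"
  unfolding p_def using theI'[OF p_ex1[OF assms, of i]] by simp

text \<open>The right-hand side of the defining equation vanishes, and \<open>w k 1\<close> can be
  cancelled. This cuts the sum in the theorem off at \<open>2 ^ t\<close>.\<close>

lemma p_neg:
  assumes "k \<ge> 1" "i < 0"
  shows "p k i = 0"
  using w1_mult_p[OF assms(1), of i] assms
  by (simp add: Q_def q_tilde_eq set_w1_0_zero w_def var_neq_0)

theorem proposition6p3:
  fixes k t :: nat
  assumes "k \<ge> 1" and "t \<ge> 1"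
  shows "Sum_any (\<lambda>i::nat. w k i * p k (2 ^ t - int i) when even i) = w k 1 ^ (2 ^ t - 1)"
proof -
  define f where "f = total_w k"
  define g where "g = Abs_fps (\<lambda>n. Q k (int n))"
  define f' where "f' = Abs_fps (\<lambda>n. set_w1_0 (fps_nth f n))"
  define g' where "g' = Abs_fps (\<lambda>n. set_w1_0 (fps_nth g n))"
  let ?N = "2 ^ t :: nat"
  let ?F = "\<lambda>i::nat. w k i * p k (2 ^ t - int i) when even i"
  have g_eq: "g = fps_right_inverse (total_w k) 1"
    by (rule fps_ext) (simp add: g_def Q_def)
  have inv: "f * g = 1"
    unfolding f_def g_eq by (rule total_w_mult_inverse)
  \<comment> \<open>Setting the first variable to 0 respects sums, products and 1, so it carries
    \<open>f * g = 1\<close> over coefficient by coefficient.\<close>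
  have inv': "f' * g' = 1"
  proof (rule fps_ext)
    fix n
    have "fps_nth (f' * g') n = set_w1_0 (fps_nth (f * g) n)"
      by (simp add: fps_mult_nth f'_def g'_def set_w1_0_sum set_w1_0_mult
          del: One_nat_def)
    also have "\<dots> = fps_nth 1 n"
      unfolding inv by (auto simp: set_w1_0_one set_w1_0_zero simp del: One_nat_def)
    finally show "fps_nth (f' * g') n = fps_nth 1 n" .
  qed
  have f_nth: "fps_nth f n = w k n" for n
    by (simp add: f_def total_w_def)
  have f'_nth: "fps_nth f' n = (if n = 1 then 0 else w k n)" for n
    by (simp add: f'_def f_nth set_w1_0_w del: One_nat_def)
  have even_part: "fps_even_part f' = fps_even_part f"
    by (rule fps_ext) (auto simp: fps_nth_even_part f_nth f'_nth)
  have supp: "{i. ?F i \<noteq> 0} \<subseteq> {0..?N}"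
  proof
    fix i assume "i \<in> {i. ?F i \<noteq> 0}"
    then have "p k (2 ^ t - int i) \<noteq> 0"
      by auto
    then have "\<not> 2 ^ t - int i < 0"
      using p_neg[OF assms(1)] by blast
    then have "int i \<le> int ?N"
      by simp
    then show "i \<in> {0..?N}"
      by (simp del: of_nat_power)
  qed
  \<comment> \<open>The factor \<open>w k 1\<close> turns each \<open>p\<close> into
    \<open>Q + q_tilde\<close>, that is, into coefficients of \<open>g\<close> and
    \<open>g'\<close>; it is cancelled at the end.\<close>
  have "w k 1 * Sum_any ?F = (\<Sum>i=0..?N. w k 1 * ?F i)"
    using Sum_any.expand_superset[OF _ supp] by (simp add: sum_distrib_left)
  also have "\<dots> = (\<Sum>i=0..?N. fps_nth (fps_even_part f) i * (fps_nth g (?N - i) + fps_nth g' (?N - i)))"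
  proof (rule sum.cong)
    fix i assume "i \<in> {0..?N}"
    then have "2 ^ t - int i = int (?N - i)"
      by (simp add: of_nat_diff)
    then have "w k 1 * p k (2 ^ t - int i) = fps_nth g (?N - i) + fps_nth g' (?N - i)"
      by (simp only: w1_mult_p[OF assms(1)]) (simp add: g_def g'_def q_tilde_eq)
    then show "w k 1 * ?F i
        = fps_nth (fps_even_part f) i * (fps_nth g (?N - i) + fps_nth g' (?N - i))"
      by (auto simp: fps_nth_even_part f_nth when_def mult.left_commute[of "w k 1"] simp del: One_nat_def)
  qed simp
  also have "\<dots> = fps_nth (fps_even_part f * g) ?N + fps_nth (fps_even_part f' * g') ?N"
    unfolding even_part by (simp add: fps_mult_nth distrib_left sum.distrib)
  also have "fps_nth (fps_even_part f * g) ?N = w k 1 ^ ?N"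
    using fps_nth_even_part_mult_inverse_power_2[OF f2poly_add_self inv]
    by (simp add: f_nth w_def)
  \<comment> \<open>The linear coefficient of \<open>f'\<close> is 0, and so is its power with the
    positive exponent \<open>2 ^ t\<close>.\<close>
  also have "fps_nth (fps_even_part f' * g') ?N = 0"
    using fps_nth_even_part_mult_inverse_power_2[OF f2poly_add_self inv']
    by (simp add: f'_nth w_def)
  also have "w k 1 ^ ?N + 0 = w k 1 * w k 1 ^ (?N - 1)"
    by (simp flip: power_Suc)
  finally show ?thesis
    using assms(1) by (simp add: w_def var_neq_0)
qed

end
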